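(* Let $\mathbb{M}$ be a PNL-model, $\mathsf{a}$ an agent of $\mathbb{M}$, and $\phi$ a dPNL formula. Then: (1) Player I has a winning strategy for the dPNL semantic game starting at $\mathbf{P},\mathbb{M},\mathsf{a}:\phi$ if and only if $\mathbb{M},\mathsf{a}\Vdash\phi$. (2) Player You has a winning strategy for the dPNL semantic game starting at $\mathbf{P},\mathbb{M},\mathsf{a}:\phi$ if and only if $\mathbb{M},\mathsf{a}\not\Vdash\phi$.
   Context: Language. Fix countable sets $\mathrm{At}$ of propositional variables and $N$ of nominals. dPNL formulas: $\phi ::= p \mid R^+(i,j)\mid R^-(i,j)\mid \neg\phi\mid\phi\wedge\phi\mid\phi\vee\phi\mid\Diamond^+\phi\mid\Diamond^-\phi\mid[A]\phi\mid\langle\wedge\!\!\wedge+\rangle\phi\mid\langle\wedge\!\!\wedge-\rangle\phi\mid\langle\wedge\!\!\wedge\pm\rangle\phi\mid\langle\oplus\rangle\phi\mid\langle\ominus\rangle\phi$ with $p\in\mathrm{At}$, $i,j\in N$. Formulas $p$, $R^+(i,j)$, $R^-(i,j)$ are elementary. In $\Diamond^\pm,R^\pm,\mathsf{R}^\pm$ the symbol $\pm$ stands for either $+$ or $-$. Models. A model is $\mathbb{M}=\langle\mathsf{A},\mathsf{R}^+,\mathsf{R}^-,\mathsf{V},\mathsf{g}\rangle$ with $\mathsf{A}$ a non-empty set of agents, $\mathsf{g}:N\to\mathsf{A}$, $\mathsf{R}^\pm\subseteq\mathsf{A}\times\mathsf{A}$, $\mathsf{V}:\mathrm{At}\to\mathcal{P}(\mathsf{A})$.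 It is a PNL-model if $\mathsf{R}^+$ is reflexive, $\mathsf{R}^+,\mathsf{R}^-$ are symmetric and $\mathsf{R}^+\cap\mathsf{R}^-=\emptyset$. $\mathbb{M}\cup\{\mathsf{a}R^\pm_\leftrightarrow\mathsf{b}\}$ is $\mathbb{M}$ with $(\mathsf{a},\mathsf{b}),(\mathsf{b},\mathsf{a})$ added to $\mathsf{R}^\pm$; $\mathbb{M}\setminus\{\mathsf{a}R^\pm_\leftrightarrow\mathsf{b}\}$ is $\mathbb{M}$ with both pairs removed from $\mathsf{R}^\pm$. Kripke semantics. $\mathbb{M},\mathsf{a}\Vdash p$ iff $\mathsf{a}\in\mathsf{V}(p)$; $\mathbb{M},\mathsf{a}\Vdash R^\pm(i,j)$ iff $(\mathsf{g}(i),\mathsf{g}(j))\in\mathsf{R}^\pm$; $\neg,\wedge,\vee$ as usual; $\mathbb{M},\mathsf{a}\Vdash\Diamond^\pm\phi$ iff $\mathbb{M},\mathsf{b}\Vdash\phi$ for some $\mathsf{b}$ with $(\mathsf{a},\mathsf{b})\in\mathsf{R}^\pm$; $\mathbb{M},\mathsf{a}\Vdash[A]\phi$ iff $\mathbb{M},\mathsf{b}\Vdash\phi$ for all $\mathsf{b}\in\mathsf{A}$; and - $\mathbb{M},\mathsf{a}\Vdash\langle\wedge\!\!\wedge+\rangle\phi$ iff there are $\mathsf{b},\mathsf{c}\in\mathsf{A}$ with $(\mathsf{b},\mathsf{c})\notin\mathsf{R}^-$ and $\mathbb{M}\cup\{\mathsf{b}R^+_\leftrightarrow\mathsf{c}\},\mathsf{a}\Vdash\phi$;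 - $\mathbb{M},\mathsf{a}\Vdash\langle\wedge\!\!\wedge-\rangle\phi$ iff there are $\mathsf{b},\mathsf{c}\in\mathsf{A}$ with $(\mathsf{b},\mathsf{c})\notin\mathsf{R}^+$ and $\mathbb{M}\cup\{\mathsf{b}R^-_\leftrightarrow\mathsf{c}\},\mathsf{a}\Vdash\phi$; - $\mathbb{M},\mathsf{a}\Vdash\langle\wedge\!\!\wedge\pm\rangle\phi$ iff at least one of the two preceding right-hand conditions holds; - $\mathbb{M},\mathsf{a}\Vdash\langle\oplus\rangle\phi$ iff there is $\mathsf{b}$ with $(\mathsf{a},\mathsf{b})\in\mathsf{R}^-$ and $\mathbb{M}\cup\{\mathsf{a}R^+_\leftrightarrow\mathsf{b}\}\setminus\{\mathsf{a}R^-_\leftrightarrow\mathsf{b}\},\mathsf{a}\Vdash\phi$; - $\mathbb{M},\mathsf{a}\Vdash\langle\ominus\rangle\phi$ iff there is $\mathsf{b}\neq\mathsf{a}$ with $(\mathsf{a},\mathsf{b})\in\mathsf{R}^+$ and $\mathbb{M}\cup\{\mathsf{a}R^-_\leftrightarrow\mathsf{b}\}\setminus\{\mathsf{a}R^+_\leftrightarrow\mathsf{b}\},\mathsf{a}\Vdash\phi$. dPNL semantic game, between players I and You. States are $\mathbf{P},\mathbb{M},\mathsf{a}:\phi$ (I am proponent) and $\mathbf{O},\mathbb{M},\mathsf{a}:\phi$ (I am opponent). Rules: - $\mathbf{P},\mathbb{M},\mathsf{a}:\phi_1\wedge\phi_2$: You choose $k\in\{1,2\}$, continue with $\mathbf{P},\mathbb{M},\mathsf{a}:\phi_k$;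 $\mathbf{P},\mathbb{M},\mathsf{a}:\phi_1\vee\phi_2$: I choose $k$, continue likewise. At the corresponding $\mathbf{O}$-states the roles of I and You are exchanged and the game continues with $\mathbf{O},\mathbb{M},\mathsf{a}:\phi_k$. - $\mathbf{P},\mathbb{M},\mathsf{a}:\neg\phi$ continues with $\mathbf{O},\mathbb{M},\mathsf{a}:\phi$; $\mathbf{O},\mathbb{M},\mathsf{a}:\neg\phi$ continues with $\mathbf{P},\mathbb{M},\mathsf{a}:\phi$. - $\mathbf{P},\mathbb{M},\mathsf{a}:\Diamond^\pm\phi$: You win if $\mathsf{a}$ has no $\mathsf{R}^\pm$-successor; otherwise I choose an $\mathsf{R}^\pm$-successor $\mathsf{b}$, continue with $\mathbf{P},\mathbb{M},\mathsf{b}:\phi$. At $\mathbf{O}$-states: roles exchanged, continuing with $\mathbf{O}$. - $\mathbf{P},\mathbb{M},\mathsf{a}:[A]\phi$: You choose an agent $\mathsf{b}$, continue with $\mathbf{P},\mathbb{M},\mathsf{b}:\phi$. $\mathbf{O},\mathbb{M},\mathsf{a}:[A]\phi$: I choose $\mathsf{b}$, continue with $\mathbf{O},\mathbb{M},\mathsf{b}:\phi$. - $\mathbf{P},\mathbb{M},\mathsf{a}:\langle\wedge\!\!\wedge-\rangle\phi$: I choose $\mathsf{b},\mathsf{c}$ with $(\mathsf{b},\mathsf{c})\notin\mathsf{R}^+$, continue with $\mathbf{P},\mathbb{M}\cup\{\mathsf{b}R^-_\leftrightarrow\mathsf{c}\},\mathsf{a}:\phi$; You win if no such $\mathsf{b},\mathsf{c}$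 exist. - $\mathbf{P},\mathbb{M},\mathsf{a}:\langle\wedge\!\!\wedge+\rangle\phi$: I choose $\mathsf{b},\mathsf{c}$ with $(\mathsf{b},\mathsf{c})\notin\mathsf{R}^-$, continue with $\mathbf{P},\mathbb{M}\cup\{\mathsf{b}R^+_\leftrightarrow\mathsf{c}\},\mathsf{a}:\phi$. - $\mathbf{P},\mathbb{M},\mathsf{a}:\langle\wedge\!\!\wedge\pm\rangle\phi$: I choose to proceed as in one of the two preceding rules. - $\mathbf{P},\mathbb{M},\mathsf{a}:\langle\oplus\rangle\phi$: I choose $\mathsf{b}$ with $(\mathsf{a},\mathsf{b})\in\mathsf{R}^-$, continue with $\mathbf{P},\mathbb{M}\cup\{\mathsf{a}R^+_\leftrightarrow\mathsf{b}\}\setminus\{\mathsf{a}R^-_\leftrightarrow\mathsf{b}\},\mathsf{a}:\phi$; You win if there is no such $\mathsf{b}$. - $\mathbf{P},\mathbb{M},\mathsf{a}:\langle\ominus\rangle\phi$: I choose $\mathsf{b}\neq\mathsf{a}$ with $(\mathsf{a},\mathsf{b})\in\mathsf{R}^+$, continue with $\mathbf{P},\mathbb{M}\cup\{\mathsf{a}R^-_\leftrightarrow\mathsf{b}\}\setminus\{\mathsf{a}R^+_\leftrightarrow\mathsf{b}\},\mathsf{a}:\phi$; You win if there is no such $\mathsf{b}$. - For the last five modalities, the $\mathbf{O}$-rules are the same with the roles of I and You exchanged and $\mathbf{O}$ in place of $\mathbf{P}$. - Elementary $\phi_e$: at $\mathbf{P},\mathbb{M},\mathsf{a}:\phi_e$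 I win iff $\mathbb{M},\mathsf{a}\Vdash\phi_e$; at $\mathbf{O},\mathbb{M},\mathsf{a}:\phi_e$ I win iff $\mathbb{M},\mathsf{a}\not\Vdash\phi_e$; otherwise You win. Winning strategies have the usual meaning for two-player zero-sum win-lose games. *)

theory Defs
  imports Main "HOL-Library.Countable"
begin

section \<open>Language and models\<close>

datatype sign = Plus | Minus

fun flip :: "sign \<Rightarrow> sign" where
  "flip Plus = Minus"
| "flip Minus = Plus"

text \<open>
  \<open>AddLink Plus\<close>, \<open>AddLink Minus\<close> and \<open>AddSome\<close> are the modalities for adding a positive link,
  a negative link, and a link of either sign, anywhere in the model. \<open>ToPos\<close> (circled plus) turns
  a negative link of the current agent into a positive one, and \<open>ToNeg\<close> (circled minus) a positive
  link to another agent into a negative one.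
\<close>

datatype ('p, 'n) form =
    Prop 'p
  | Rel sign 'n 'n
  | Neg "('p, 'n) form"
  | Conj "('p, 'n) form" "('p, 'n) form"
  | Disj "('p, 'n) form" "('p, 'n) form"
  | Dia sign "('p, 'n) form"
  | Univ "('p, 'n) form"
  | AddLink sign "('p, 'n) form"
  | AddSome "('p, 'n) form"
  | ToPos "('p, 'n) form"
  | ToNeg "('p, 'n) form"

fun elementary :: "('p, 'n) form \<Rightarrow> bool" where
  "elementary (Prop p) = True"
| "elementary (Rel s i j) = True"
| "elementary _ = False"

record ('a, 'p, 'n) model =
  agents :: "'a set"
  rel :: "sign \<Rightarrow> ('a \<times> 'a) set"
  val :: "'p \<Rightarrow> 'a set"
  nom :: "'n \<Rightarrow> 'a"

definition is_model :: "('a, 'p, 'n) model \<Rightarrow> bool" where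
  "is_model M \<longleftrightarrow>
     agents M \<noteq> {} \<and>
     (\<forall>i. nom M i \<in> agents M) \<and>
     (\<forall>s. rel M s \<subseteq> agents M \<times> agents M) \<and>
     (\<forall>p. val M p \<subseteq> agents M)"

definition PNL_model :: "('a, 'p, 'n) model \<Rightarrow> bool" where
  "PNL_model M \<longleftrightarrow>
     is_model M \<and>
     refl_on (agents M) (rel M Plus) \<and>
     sym (rel M Plus) \<and> sym (rel M Minus) \<and>
     rel M Plus \<inter> rel M Minus = {}"

definition add_link :: "sign \<Rightarrow> 'a \<Rightarrow> 'a \<Rightarrow> ('a, 'p, 'n) model \<Rightarrow> ('a, 'p, 'n) model" where
  "add_link s a b M = M\<lparr>rel := (rel M)(s := rel M s \<union> {(a, b), (b, a)})\<rparr>"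

definition del_link :: "sign \<Rightarrow> 'a \<Rightarrow> 'a \<Rightarrow> ('a, 'p, 'n) model \<Rightarrow> ('a, 'p, 'n) model" where
  "del_link s a b M = M\<lparr>rel := (rel M)(s := rel M s - {(a, b), (b, a)})\<rparr>"


section \<open>Kripke semantics\<close>

primrec sat :: "('a, 'p, 'n) model \<Rightarrow> 'a \<Rightarrow> ('p, 'n) form \<Rightarrow> bool" where
  "sat M a (Prop p) \<longleftrightarrow> a \<in> val M p"
| "sat M a (Rel s i j) \<longleftrightarrow> (nom M i, nom M j) \<in> rel M s"
| "sat M a (Neg \<phi>) \<longleftrightarrow> \<not> sat M a \<phi>"
| "sat M a (Conj \<phi> \<psi>) \<longleftrightarrow> sat M a \<phi> \<and> sat M a \<psi>"
| "sat M a (Disj \<phi> \<psi>) \<longleftrightarrow> sat M a \<phi> \<or> sat M a \<psi>"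
| "sat M a (Dia s \<phi>) \<longleftrightarrow> (\<exists>b. (a, b) \<in> rel M s \<and> sat M b \<phi>)"
| "sat M a (Univ \<phi>) \<longleftrightarrow> (\<forall>b\<in>agents M. sat M b \<phi>)"
| "sat M a (AddLink s \<phi>) \<longleftrightarrow>
     (\<exists>b\<in>agents M. \<exists>c\<in>agents M. (b, c) \<notin> rel M (flip s) \<and> sat (add_link s b c M) a \<phi>)"
| "sat M a (AddSome \<phi>) \<longleftrightarrow>
     (\<exists>b\<in>agents M. \<exists>c\<in>agents M. (b, c) \<notin> rel M Minus \<and> sat (add_link Plus b c M) a \<phi>) \<or>
     (\<exists>b\<in>agents M. \<exists>c\<in>agents M. (b, c) \<notin> rel M Plus \<and> sat (add_link Minus b c M) a \<phi>)"
| "sat M a (ToPos \<phi>) \<longleftrightarrow>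
     (\<exists>b. (a, b) \<in> rel M Minus \<and> sat (del_link Minus a b (add_link Plus a b M)) a \<phi>)"
| "sat M a (ToNeg \<phi>) \<longleftrightarrow>
     (\<exists>b. b \<noteq> a \<and> (a, b) \<in> rel M Plus \<and> sat (del_link Plus a b (add_link Minus a b M)) a \<phi>)"


section \<open>The semantic game\<close>

datatype player = Me | You

fun rival :: "player \<Rightarrow> player" where
  "rival Me = You"
| "rival You = Me"

text \<open>The role recorded in a state is the role of player \<open>Me\<close>.\<close>

datatype role = Pro | Opp

fun swap :: "role \<Rightarrow> role" where
  "swap Pro = Opp"
| "swap Opp = Pro"

fun proponent :: "role \<Rightarrow> player" where
  "proponent Pro = Me"
| "proponent Opp = You"

type_synonym ('a, 'p, 'n) state = "role \<times> ('a, 'p, 'n) model \<times> 'a \<times> ('p, 'n) form"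

text \<open>
  The player who chooses the next state; there is none at an elementary formula (the game is over)
  or at a negation (the next state is forced).
\<close>

fun chooser :: "('a, 'p, 'n) state \<Rightarrow> player option" where
  "chooser (r, M, a, Prop p) = None"
| "chooser (r, M, a, Rel s i j) = None"
| "chooser (r, M, a, Neg \<phi>) = None"
| "chooser (r, M, a, Conj \<phi> \<psi>) = Some (rival (proponent r))"
| "chooser (r, M, a, Disj \<phi> \<psi>) = Some (proponent r)"
| "chooser (r, M, a, Dia s \<phi>) = Some (proponent r)"
| "chooser (r, M, a, Univ \<phi>) = Some (rival (proponent r))"
| "chooser (r, M, a, AddLink s \<phi>) = Some (proponent r)"
| "chooser (r, M, a, AddSome \<phi>) = Some (proponent r)"
| "chooser (r, M, a, ToPos \<phi>) = Some (proponent r)"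
| "chooser (r, M, a, ToNeg \<phi>) = Some (proponent r)"

text \<open>
  At \<open>AddSome \<phi>\<close> the chooser only picks the sign, and then plays by the rule for \<open>AddLink\<close> with
  that sign. In particular a sign for which no admissible pair exists may be picked, and loses.
\<close>

fun moves :: "('a, 'p, 'n) state \<Rightarrow> ('a, 'p, 'n) state set" where
  "moves (r, M, a, Prop p) = {}"
| "moves (r, M, a, Rel s i j) = {}"
| "moves (r, M, a, Neg \<phi>) = {(swap r, M, a, \<phi>)}"
| "moves (r, M, a, Conj \<phi> \<psi>) = {(r, M, a, \<phi>), (r, M, a, \<psi>)}"
| "moves (r, M, a, Disj \<phi> \<psi>) = {(r, M, a, \<phi>), (r, M, a, \<psi>)}"
| "moves (r, M, a, Dia s \<phi>) = {(r, M, b, \<phi>) | b. (a, b) \<in> rel M s}"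
| "moves (r, M, a, Univ \<phi>) = {(r, M, b, \<phi>) | b. b \<in> agents M}"
| "moves (r, M, a, AddLink s \<phi>) =
     {(r, add_link s b c M, a, \<phi>) | b c. b \<in> agents M \<and> c \<in> agents M \<and> (b, c) \<notin> rel M (flip s)}"
| "moves (r, M, a, AddSome \<phi>) = {(r, M, a, AddLink Plus \<phi>), (r, M, a, AddLink Minus \<phi>)}"
| "moves (r, M, a, ToPos \<phi>) =
     {(r, del_link Minus a b (add_link Plus a b M), a, \<phi>) | b. (a, b) \<in> rel M Minus}"
| "moves (r, M, a, ToNeg \<phi>) =
     {(r, del_link Plus a b (add_link Minus a b M), a, \<phi>) | b. b \<noteq> a \<and> (a, b) \<in> rel M Plus}"

text \<open>
  The winner when the game ends at the given state, i.e. when the state has no moves: an elementary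
  formula is decided by its truth value, and otherwise the player who had to choose is stuck and
  loses. The value at states with moves is irrelevant.
\<close>

fun winner :: "('a, 'p, 'n) state \<Rightarrow> player" where
  "winner (r, M, a, \<phi>) =
     (if elementary \<phi>
      then (if sat M a \<phi> then proponent r else rival (proponent r))
      else rival (the (chooser (r, M, a, \<phi>))))"


section \<open>Strategies\<close>

definition history :: "('a, 'p, 'n) state \<Rightarrow> ('a, 'p, 'n) state list \<Rightarrow> bool" where
  "history s h \<longleftrightarrow> h \<noteq> [] \<and> hd h = s \<and> successively (\<lambda>t u. u \<in> moves t) h"

definition complete_play :: "('a, 'p, 'n) state \<Rightarrow> ('a, 'p, 'n) state list \<Rightarrow> bool" where
  "complete_play s h \<longleftrightarrow> history s h \<and> moves (last h) = {}"

text \<open>Finite lists suffice to represent the plays, since there are no infinite ones:\<close>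

lemma no_infinite_play:
  fixes f :: "nat \<Rightarrow> ('a, 'p, 'n) state"
  shows "\<not> (\<forall>k. f (Suc k) \<in> moves (f k))"
proof
  assume *: "\<forall>k. f (Suc k) \<in> moves (f k)"
  define w :: "('a, 'p, 'n) state \<Rightarrow> nat" where
    "w = (\<lambda>(r, M, a, \<phi>). 2 * size \<phi> + (case \<phi> of AddSome \<psi> \<Rightarrow> 1 | _ \<Rightarrow> 0))"
  have "w t < w s" if "t \<in> moves s" for s t :: "('a, 'p, 'n) state"
    using that by (cases s rule: moves.cases) (auto simp: w_def split: form.splits)
  with * have "\<forall>k. (f (Suc k), f k) \<in> measure w" by simp
  then show False
    using wf_measure[of w] unfolding wf_iff_no_infinite_down_chain by blast
qed

text \<open>A strategy from \<open>s\<close> selects a legal move at every history where it is player \<open>X\<close>'s choice.\<close>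

definition strategy ::
  "player \<Rightarrow> ('a, 'p, 'n) state \<Rightarrow> (('a, 'p, 'n) state list \<Rightarrow> ('a, 'p, 'n) state) \<Rightarrow> bool" where
  "strategy X s \<sigma> \<longleftrightarrow>
     (\<forall>h. history s h \<and> chooser (last h) = Some X \<and> moves (last h) \<noteq> {}
        \<longrightarrow> \<sigma> h \<in> moves (last h))"

definition follows ::
  "player \<Rightarrow> (('a, 'p, 'n) state list \<Rightarrow> ('a, 'p, 'n) state) \<Rightarrow> ('a, 'p, 'n) state list \<Rightarrow> bool" where
  "follows X \<sigma> h \<longleftrightarrow>
     (\<forall>k. Suc k < length h \<and> chooser (h ! k) = Some X \<longrightarrow> h ! Suc k = \<sigma> (take (Suc k) h))"

definition winning_strategy ::
  "player \<Rightarrow> ('a, 'p, 'n) state \<Rightarrow> (('a, 'p, 'n) state list \<Rightarrow> ('a, 'p, 'n) state) \<Rightarrow> bool" where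
  "winning_strategy X s \<sigma> \<longleftrightarrow>
     strategy X s \<sigma> \<and>
     (\<forall>h. complete_play s h \<and> follows X \<sigma> h \<longrightarrow> winner (last h) = X)"

definition has_winning_strategy :: "player \<Rightarrow> ('a, 'p, 'n) state \<Rightarrow> bool" where
  "has_winning_strategy X s \<longleftrightarrow> (\<exists>\<sigma>. winning_strategy X s \<sigma>)"

end

theory Submission
  imports Defs
begin

text \<open>
  Assign to every state the player favoured by the truth value of its formula. Whoever is favoured
  can stay favoured: if it is their choice, some move keeps them favoured, and otherwise all moves do.
  Moreover, the favoured player wins when the game ends. Hence choosing moves that keep oneself
  favoured is a winning strategy for the favoured player, and the same moves played against any
  strategy of the other player refute it, since there are no infinite plays.
\<close>

fun favoured :: "('a, 'p, 'n) state \<Rightarrow> player" where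
  "favoured (r, M, a, \<phi>) = (if sat M a \<phi> then proponent r else rival (proponent r))"

lemma rival_neq [simp]: "rival X \<noteq> X" "X \<noteq> rival X"
  by (cases X; simp)+

lemma rival_rival [simp]: "rival (rival X) = X"
  by (cases X) auto

lemma neq_iff_eq_rival: "X \<noteq> Y \<longleftrightarrow> X = rival Y"
  by (cases X; cases Y) auto

lemma proponent_swap [simp]: "proponent (swap r) = rival (proponent r)"
  by (cases r) auto

text \<open>Where the proponent chooses, truth is existential over the moves; where the rival
  chooses, truth is universal, hence falsity existential.\<close>

lemma favoured_move_exists:
  assumes "chooser s = Some (favoured s)"
  shows "\<exists>t\<in>moves s. favoured t = favoured s"
  using assms
  by (cases s rule: moves.cases)
    (simp_all split: if_splits, (fastforce simp: Bex_def)+)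

text \<open>If the other player chooses, this is the dual of \<open>favoured_move_exists\<close>. If
  nobody chooses but a move exists, the formula is a negation: the change of truth value and the
  swap of roles cancel.\<close>

lemma favoured_moves:
  assumes "chooser s \<noteq> Some (favoured s)" and "t \<in> moves s"
  shows "favoured t = favoured s"
  using assms by (cases s rule: moves.cases) (auto split: if_splits)

lemma winner_eq_favoured:
  assumes "moves s = {}"
  shows "winner s = favoured s"
proof -
  obtain r M a \<phi> where s: "s = (r, M, a, \<phi>)"
    by (cases s) auto
  show ?thesis
  proof (cases "elementary \<phi>")
    case False
    \<comment> \<open>A negation always has a move, so a stuck state with a non-elementary formula
      has a chooser. By \<open>favoured_move_exists\<close> this chooser is not favoured.\<close>
    with assms s obtain Y where Y: "chooser s = Some Y"
      by (cases s rule: chooser.cases) auto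
    moreover have "favoured s \<noteq> Y"
      using favoured_move_exists[of s] assms Y by auto
    ultimately show ?thesis
      using False by (simp add: s neq_iff_eq_rival del: favoured.simps)
  qed (simp add: s)
qed

declare favoured.simps [simp del] winner.simps [simp del]

lemma wf_moves: "wf {(t, s). t \<in> moves s}"
  unfolding wf_iff_no_infinite_down_chain using no_infinite_play by auto

lemma history_snoc:
  "h \<noteq> [] \<Longrightarrow> history s (h @ [t]) \<longleftrightarrow> history s h \<and> t \<in> moves (last h)"
  by (auto simp: history_def successively_append_iff)

lemma follows_snoc:
  assumes "h \<noteq> []"
  shows "follows X \<sigma> (h @ [t]) \<longleftrightarrow>
    follows X \<sigma> h \<and> (chooser (last h) = Some X \<longrightarrow> t = \<sigma> h)"
proof -
  obtain n where n: "length h = Suc n"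
    using assms by (cases h) auto
  \<comment> \<open>Appending \<open>t\<close> adds only the condition at index \<open>n\<close>,
    where the prefix read by the strategy is all of \<open>h\<close>.\<close>
  then have "h ! n = last h" and "take (Suc n) h = h"
    using assms by (simp_all add: last_conv_nth)
  with n show ?thesis
    by (auto simp: follows_def nth_append less_Suc_eq all_conj_distrib)
qed

text \<open>The second branch is a default: \<open>strategy\<close> demands a legal move also at
  histories where \<open>X\<close> is not favoured.\<close>

definition favouring :: "player \<Rightarrow> ('a, 'p, 'n) state list \<Rightarrow> ('a, 'p, 'n) state" where
  "favouring X h =
     (if favoured (last h) = X then SOME t. t \<in> moves (last h) \<and> favoured t = X
      else SOME t. t \<in> moves (last h))"

lemma favouring_move:
  assumes "chooser (last h) = Some X" and "favoured (last h) = X"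
  shows "favouring X h \<in> moves (last h)" and "favoured (favouring X h) = X"
proof -
  have "\<exists>t. t \<in> moves (last h) \<and> favoured t = X"
    using favoured_move_exists[of "last h"] assms by auto
  from someI_ex[OF this]
  show "favouring X h \<in> moves (last h)" and "favoured (favouring X h) = X"
    using assms(2) by (simp_all add: favouring_def)
qed

lemma strategy_favouring: "strategy X s (favouring X)"
  unfolding strategy_def
proof (intro allI impI, elim conjE)
  fix h :: "('a, 'b, 'c) state list"
  assume *: "chooser (last h) = Some X" "moves (last h) \<noteq> {}"
  show "favouring X h \<in> moves (last h)"
  proof (cases "favoured (last h) = X")
    case True
    then show ?thesis
      using favouring_move(1) * by blast
  next
    case False
    then show ?thesis
      using * by (auto simp: favouring_def some_in_eq)
  qed
qed

text \<open>Being favoured is an invariant: \<open>X\<close> preserves it by the choice of move, and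
  no other move can destroy it.\<close>

lemma favoured_last:
  assumes "history s h" and "follows X (favouring X) h" and "favoured s = X"
  shows "favoured (last h) = X"
  using assms(1,2)
proof (induction h rule: rev_induct)
  case (snoc t h)
  show ?case
  proof (cases "h = []")
    case True
    then show ?thesis
      using snoc.prems(1) assms(3) by (simp add: history_def)
  next
    case False
    then have h: "history s h" "t \<in> moves (last h)" "follows X (favouring X) h"
        "chooser (last h) = Some X \<longrightarrow> t = favouring X h"
      using snoc.prems by (simp_all add: history_snoc follows_snoc)
    then have "favoured (last h) = X"
      using snoc.IH by blast
    then have "favoured t = X"
      using h favouring_move(2)[of h] favoured_moves[of "last h" t] by (cases "chooser (last h) = Some X") auto
    then show ?thesis
      by simp
  qed
qed (simp add: history_def)

lemma favoured_has_winning_strategy: "has_winning_strategy (favoured s) s"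
  unfolding has_winning_strategy_def winning_strategy_def complete_play_def
  using strategy_favouring favoured_last winner_eq_favoured by metis

text \<open>Extend \<open>h\<close> move by move while the rival of \<open>X\<close> stays favoured.
  The history grows, but its last state descends along a well-founded relation, so the extension
  ends in a complete play that \<open>X\<close> loses.\<close>

lemma refuting_play:
  assumes "strategy X s \<sigma>" and "history s h" and "follows X \<sigma> h" and "favoured (last h) \<noteq> X"
  shows "\<exists>h'. complete_play s h' \<and> follows X \<sigma> h' \<and> winner (last h') \<noteq> X"
  using assms(2-4)
proof (induction "last h" arbitrary: h rule: wf_induct_rule[OF wf_moves])
  case (1 h)
  have "h \<noteq> []"
    using 1(2) by (simp add: history_def)
  show ?case
  proof (cases "moves (last h) = {}")
    case True
    then show ?thesis
      using 1(2-4) winner_eq_favoured[of "last h"] by (auto simp: complete_play_def)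
  next
    case False
    \<comment> \<open>If \<open>X\<close> chooses, the move dictated by \<sigma> cannot gain favour.
      If the rival chooses, some move keeps the rival favoured; if nobody chooses, every move
      does.\<close>
    have "\<exists>t\<in>moves (last h). favoured t \<noteq> X \<and> (chooser (last h) = Some X \<longrightarrow> t = \<sigma> h)"
    proof (cases "chooser (last h) = Some X")
      case True
      then have "\<sigma> h \<in> moves (last h)"
        using assms(1) 1(2) False by (auto simp: strategy_def)
      then show ?thesis
        using favoured_moves[of "last h"] True 1(4) by auto
    next
      case not_X: False
      then show ?thesis
        using favoured_moves[of "last h"] favoured_move_exists[of "last h"] False 1(4)
        by (metis ex_in_conv)
    qed
    then obtain t where "t \<in> moves (last h)" "favoured t \<noteq> X"
        "chooser (last h) = Some X \<longrightarrow> t = \<sigma> h"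
      by blast
    then show ?thesis
      using 1(1)[of "h @ [t]"] 1(2,3) \<open>h \<noteq> []\<close> by (simp add: history_snoc follows_snoc)
  qed
qed

lemma has_winning_strategy_iff_favoured: "has_winning_strategy X s \<longleftrightarrow> favoured s = X"
proof
  assume "has_winning_strategy X s"
  then obtain \<sigma> where "winning_strategy X s \<sigma>"
    by (auto simp: has_winning_strategy_def)
  moreover have "history s [s]" "follows X \<sigma> [s]"
    by (simp_all add: history_def follows_def)
  \<comment> \<open>If \<open>X\<close> were not favoured, the one-state history \<open>[s]\<close>
    would extend to a complete play that follows \<sigma> and is lost by \<open>X\<close>.\<close>
  ultimately show "favoured s = X"
    using refuting_play[of X s \<sigma> "[s]"] by (auto simp: winning_strategy_def)
qed (use favoured_has_winning_strategy in blast)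

theorem theorem5:
  fixes M :: "('a, 'p::countable, 'n::countable) model"
    and a :: 'a
    and \<phi> :: "('p, 'n) form"
  assumes "PNL_model M" and "a \<in> agents M"
  shows "(has_winning_strategy Me (Pro, M, a, \<phi>) \<longleftrightarrow> sat M a \<phi>) \<and>
         (has_winning_strategy You (Pro, M, a, \<phi>) \<longleftrightarrow> \<not> sat M a \<phi>)"
  by (simp add: has_winning_strategy_iff_favoured favoured.simps)

end
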